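(* Let $(W,S)$ be a Coxeter system of type $\Lambda$ and let $\alpha$ be a reduced expression. Then the braid graph $\mathcal{B}(\alpha)$ is a median graph.
   Context: A Coxeter system $(W,S)$ consists of a finite set $S$ and the group $W=\langle S\mid (st)^{m(s,t)}=e\rangle$, where $m(s,s)=1$ and $m(s,t)=m(t,s)\in\{2,3,\dots\}\cup\{\infty\}$ for $s\neq t$ ($m(s,t)=\infty$ means no relation). Its Coxeter graph has vertex set $S$ and an edge $\{s,t\}$ whenever $m(s,t)\ge 3$. $(W,S)$ is of type $\Lambda$ if $m(s,t)\le 3$ for all $s,t\in S$ (simply laced) and the Coxeter graph contains no three-cycles (triangle free). A reduced expression for $w\in W$ is a word over $S$ of minimal length representing $w$. A braid move replaces three consecutive letters $sts$ by $tst$, where $m(s,t)=3$. Two reduced expressions are braid equivalent if they are related by a finite sequence of braid moves; $[\alpha]$ denotes the braid class (equivalence class) of $\alpha$. The braid graph $\mathcal{B}(\alpha)$ has vertex set $[\alpha]$, with two vertices adjacent if and only if they are related by a single braid move. In a connected graph $G$ with path metric $d$, the interval between vertices is $I(u,v)=\{w\in V(G)\mid d(u,v)=d(u,w)+d(w,v)\}$. $G$ is median if $|I(u,v)\cap I(u,w)\cap I(v,w)|=1$ for all $u,v,w\in V(G)$. *)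

theory Defs
  imports "HOL-Library.Extended_Nat" "HOL-Algebra.Group"
begin

section \<open>Groups given by generators and relators\<close>

text \<open>The letter \<open>(x, True)\<close> stands for the generator \<open>x\<close> and \<open>(x, False)\<close> for its formal inverse.\<close>

definition signed_words :: "'a set \<Rightarrow> ('a \<times> bool) list set" where
  "signed_words X = lists (X \<times> UNIV)"

inductive_set pres_rel :: "'a set \<Rightarrow> ('a \<times> bool) list set \<Rightarrow> (('a \<times> bool) list \<times> ('a \<times> bool) list) set"
  for X :: "'a set" and R :: "('a \<times> bool) list set" where
  refl: "u \<in> signed_words X \<Longrightarrow> (u, u) \<in> pres_rel X R"
| sym: "(u, v) \<in> pres_rel X R \<Longrightarrow> (v, u) \<in> pres_rel X R"
| trans: "(u, v) \<in> pres_rel X R \<Longrightarrow> (v, w) \<in> pres_rel X R \<Longrightarrow> (u, w) \<in> pres_rel X R"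
| cancel: "u \<in> signed_words X \<Longrightarrow> v \<in> signed_words X \<Longrightarrow> x \<in> X \<Longrightarrow>
    (u @ [(x, b), (x, \<not> b)] @ v, u @ v) \<in> pres_rel X R"
| relator: "u \<in> signed_words X \<Longrightarrow> v \<in> signed_words X \<Longrightarrow> r \<in> R \<Longrightarrow> r \<in> signed_words X \<Longrightarrow>
    (u @ r @ v, u @ v) \<in> pres_rel X R"

definition presented_group :: "'a set \<Rightarrow> ('a \<times> bool) list set \<Rightarrow> ('a \<times> bool) list set monoid" where
  "presented_group X R =
    \<lparr>carrier = signed_words X // pres_rel X R,
     mult = (\<lambda>A B. \<Union>a\<in>A. \<Union>b\<in>B. pres_rel X R `` {a @ b}),
     one = pres_rel X R `` {[]}\<rparr>"

lemma pres_rel_words: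
  "(u, v) \<in> pres_rel X R \<Longrightarrow> u \<in> signed_words X \<and> v \<in> signed_words X"
  by (induction rule: pres_rel.induct) (auto simp: signed_words_def)

lemma equiv_pres_rel: "equiv (signed_words X) (pres_rel X R)"
proof (rule equivI)
  show "pres_rel X R \<subseteq> signed_words X \<times> signed_words X"
    using pres_rel_words by fastforce
  show "refl_on (signed_words X) (pres_rel X R)"
    by (auto simp: refl_on_def intro: pres_rel.refl)
  show "sym_on UNIV (pres_rel X R)"
    by (auto intro: symI pres_rel.sym)
  show "trans_on UNIV (pres_rel X R)"
    by (auto intro: transI pres_rel.trans)
qed

lemma pres_rel_context:
  assumes "(u, v) \<in> pres_rel X R" "p \<in> signed_words X" "q \<in> signed_words X"
  shows "(p @ u @ q, p @ v @ q) \<in> pres_rel X R"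
  using assms
proof (induction rule: pres_rel.induct)
  case (refl u)
  then show ?case by (auto simp: signed_words_def intro!: pres_rel.refl)
next
  case (cancel u v x b)
  then show ?case
    using pres_rel.cancel[of "p @ u" X "v @ q" x b R] by (auto simp: signed_words_def)
next
  case (relator u v r)
  then show ?case
    using pres_rel.relator[of "p @ u" X "v @ q" r R] by (auto simp: signed_words_def)
qed (auto intro: pres_rel.sym pres_rel.trans)

lemma pres_rel_append:
  assumes "(u, u') \<in> pres_rel X R" "(v, v') \<in> pres_rel X R"
  shows "(u @ v, u' @ v') \<in> pres_rel X R"
proof -
  have w: "v \<in> signed_words X" "u' \<in> signed_words X" "[] \<in> signed_words X"
    using pres_rel_words[OF assms(1)] pres_rel_words[OF assms(2)] by (auto simp: signed_words_def)
  have "(u @ v, u' @ v) \<in> pres_rel X R"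
    using pres_rel_context[OF assms(1) w(3) w(1)] by simp
  moreover have "(u' @ v, u' @ v') \<in> pres_rel X R"
    using pres_rel_context[OF assms(2) w(2) w(3)] by simp
  ultimately show ?thesis by (rule pres_rel.trans)
qed

lemma presented_group_mult:
  assumes "u \<in> signed_words X" "v \<in> signed_words X"
  shows "(pres_rel X R `` {u}) \<otimes>\<^bsub>presented_group X R\<^esub> (pres_rel X R `` {v}) = pres_rel X R `` {u @ v}"
proof -
  have "congruent2 (pres_rel X R) (pres_rel X R) (\<lambda>a b. pres_rel X R `` {a @ b})"
    by (rule congruent2I') (rule equiv_class_eq[OF equiv_pres_rel pres_rel_append])
  from UN_equiv_class2[OF equiv_pres_rel equiv_pres_rel this assms]
  show ?thesis by (simp add: presented_group_def)
qed

lemma pres_rel_inverse: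
  assumes "u \<in> signed_words X"
  shows "(rev (map (\<lambda>(x, b). (x, \<not> b)) u) @ u, []) \<in> pres_rel X R"
  using assms
proof (induction u)
  case Nil
  then show ?case by (auto intro: pres_rel.refl simp: signed_words_def)
next
  case (Cons a u)
  obtain x b where a: "a = (x, b)" by fastforce
  have x: "x \<in> X" and u: "u \<in> signed_words X"
    using Cons.prems a by (auto simp: signed_words_def)
  have i: "rev (map (\<lambda>(x, b). (x, \<not> b)) u) \<in> signed_words X"
    using u by (auto simp: signed_words_def in_lists_conv_set)
  show ?case
    using pres_rel.trans[OF pres_rel.cancel[OF i u x, of "\<not> b" R] Cons.IH[OF u]] a by simp
qed

lemma group_presented_group: "group (presented_group X R)"
proof (rule groupI)
  have nil: "[] \<in> signed_words X" and app: "\<And>u v. u \<in> signed_words X \<Longrightarrow> v \<in> signed_words X \<Longrightarrow> u @ v \<in> signed_words X"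
    by (auto simp: signed_words_def)
  have car: "carrier (presented_group X R) = signed_words X // pres_rel X R"
    and one: "\<one>\<^bsub>presented_group X R\<^esub> = pres_rel X R `` {[]}"
    by (simp_all add: presented_group_def)
  show "\<one>\<^bsub>presented_group X R\<^esub> \<in> carrier (presented_group X R)"
    by (simp add: car one nil quotientI)
  fix A assume "A \<in> carrier (presented_group X R)"
  then obtain a where a: "a \<in> signed_words X" and A: "A = pres_rel X R `` {a}"
    by (auto simp: car elim: quotientE)
  show "\<one>\<^bsub>presented_group X R\<^esub> \<otimes>\<^bsub>presented_group X R\<^esub> A = A"
    by (simp add: one A presented_group_mult[OF nil a])
  have i: "rev (map (\<lambda>(x, b). (x, \<not> b)) a) \<in> signed_words X" (is "?i \<in> _")
    using a by (auto simp: signed_words_def in_lists_conv_set)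
  have "(pres_rel X R `` {?i}) \<otimes>\<^bsub>presented_group X R\<^esub> A = \<one>\<^bsub>presented_group X R\<^esub>"
    by (simp add: A one presented_group_mult[OF i a]
        equiv_class_eq[OF equiv_pres_rel pres_rel_inverse[OF a]])
  then show "\<exists>B\<in>carrier (presented_group X R). B \<otimes>\<^bsub>presented_group X R\<^esub> A = \<one>\<^bsub>presented_group X R\<^esub>"
    using i by (auto simp: car intro: quotientI)
  fix B assume "B \<in> carrier (presented_group X R)"
  then obtain b where b: "b \<in> signed_words X" and B: "B = pres_rel X R `` {b}"
    by (auto simp: car elim: quotientE)
  show "A \<otimes>\<^bsub>presented_group X R\<^esub> B \<in> carrier (presented_group X R)"
    by (simp add: A B presented_group_mult[OF a b] car app a b quotientI)
  fix C assume "C \<in> carrier (presented_group X R)"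
  then obtain c where c: "c \<in> signed_words X" and C: "C = pres_rel X R `` {c}"
    by (auto simp: car elim: quotientE)
  show "A \<otimes>\<^bsub>presented_group X R\<^esub> B \<otimes>\<^bsub>presented_group X R\<^esub> C
      = A \<otimes>\<^bsub>presented_group X R\<^esub> (B \<otimes>\<^bsub>presented_group X R\<^esub> C)"
    by (simp add: A B C presented_group_mult a b c app)
qed


section \<open>Graphs\<close>

type_synonym 'v ugraph = "'v set \<times> 'v set set"

definition simple_graph :: "'v ugraph \<Rightarrow> bool" where
  "simple_graph G \<longleftrightarrow> (\<forall>e\<in>snd G. \<exists>u\<in>fst G. \<exists>v\<in>fst G. u \<noteq> v \<and> e = {u, v})"

definition triangle_free :: "'v ugraph \<Rightarrow> bool" where
  "triangle_free G \<longleftrightarrow>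
    \<not> (\<exists>x y z. distinct [x, y, z] \<and> {x, y} \<in> snd G \<and> {y, z} \<in> snd G \<and> {x, z} \<in> snd G)"

definition walk :: "'v ugraph \<Rightarrow> 'v \<Rightarrow> 'v list \<Rightarrow> 'v \<Rightarrow> bool" where
  "walk G u p v \<longleftrightarrow> p \<noteq> [] \<and> hd p = u \<and> last p = v \<and> set p \<subseteq> fst G \<and>
    successively (\<lambda>x y. {x, y} \<in> snd G) p"

definition connected_graph :: "'v ugraph \<Rightarrow> bool" where
  "connected_graph G \<longleftrightarrow> simple_graph G \<and> (\<forall>u\<in>fst G. \<forall>v\<in>fst G. \<exists>p. walk G u p v)"

text \<open>The length of a walk is its number of edges, one less than the length of the list of its
  vertices. The value is meaningful only if some walk joins \<open>u\<close> and \<open>v\<close>.\<close>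

definition graph_dist :: "'v ugraph \<Rightarrow> 'v \<Rightarrow> 'v \<Rightarrow> nat" where
  "graph_dist G u v = (LEAST n. \<exists>p. walk G u p v \<and> length p = Suc n)"

definition interval :: "'v ugraph \<Rightarrow> 'v \<Rightarrow> 'v \<Rightarrow> 'v set" where
  "interval G u v = {w \<in> fst G. graph_dist G u v = graph_dist G u w + graph_dist G w v}"

definition median_graph :: "'v ugraph \<Rightarrow> bool" where
  "median_graph G \<longleftrightarrow> connected_graph G \<and>
    (\<forall>u\<in>fst G. \<forall>v\<in>fst G. \<forall>w\<in>fst G.
      card (interval G u v \<inter> interval G u w \<inter> interval G v w) = 1)"


section \<open>Coxeter systems\<close>

definition coxeter_matrix :: "'a set \<Rightarrow> ('a \<Rightarrow> 'a \<Rightarrow> enat) \<Rightarrow> bool" where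
  "coxeter_matrix S m \<longleftrightarrow> finite S \<and> (\<forall>s\<in>S. m s s = 1) \<and>
    (\<forall>s\<in>S. \<forall>t\<in>S. s \<noteq> t \<longrightarrow> m s t = m t s \<and> 2 \<le> m s t)"

text \<open>A pair with \<open>m s t = \<infinity>\<close> contributes no relator.\<close>

definition coxeter_relators :: "'a set \<Rightarrow> ('a \<Rightarrow> 'a \<Rightarrow> enat) \<Rightarrow> ('a \<times> bool) list set" where
  "coxeter_relators S m =
    {concat (replicate k [(s, True), (t, True)]) | s t k. s \<in> S \<and> t \<in> S \<and> m s t = enat k}"

definition coxeter_group :: "'a set \<Rightarrow> ('a \<Rightarrow> 'a \<Rightarrow> enat) \<Rightarrow> ('a \<times> bool) list set monoid" where
  "coxeter_group S m = presented_group S (coxeter_relators S m)"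

definition coxeter_graph :: "'a set \<Rightarrow> ('a \<Rightarrow> 'a \<Rightarrow> enat) \<Rightarrow> 'a ugraph" where
  "coxeter_graph S m = (S, {{s, t} | s t. s \<in> S \<and> t \<in> S \<and> 3 \<le> m s t})"

definition type_Lambda :: "'a set \<Rightarrow> ('a \<Rightarrow> 'a \<Rightarrow> enat) \<Rightarrow> bool" where
  "type_Lambda S m \<longleftrightarrow> (\<forall>s\<in>S. \<forall>t\<in>S. m s t \<le> 3) \<and> triangle_free (coxeter_graph S m)"

text \<open>The element of the Coxeter group, a class of signed words, represented by a word over \<open>S\<close>.\<close>

definition word_elem :: "'a set \<Rightarrow> ('a \<Rightarrow> 'a \<Rightarrow> enat) \<Rightarrow> 'a list \<Rightarrow> ('a \<times> bool) list set" where
  "word_elem S m \<alpha> = pres_rel S (coxeter_relators S m) `` {map (\<lambda>s. (s, True)) \<alpha>}"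

lemma word_elem_Nil: "word_elem S m [] = \<one>\<^bsub>coxeter_group S m\<^esub>"
  by (simp add: word_elem_def coxeter_group_def presented_group_def)

lemma word_elem_append:
  assumes "\<alpha> \<in> lists S" "\<beta> \<in> lists S"
  shows "word_elem S m (\<alpha> @ \<beta>) = word_elem S m \<alpha> \<otimes>\<^bsub>coxeter_group S m\<^esub> word_elem S m \<beta>"
proof -
  have "map (\<lambda>s. (s, True)) \<alpha> \<in> signed_words S" "map (\<lambda>s. (s, True)) \<beta> \<in> signed_words S"
    using assms by (auto simp: signed_words_def in_lists_conv_set)
  then show ?thesis
    by (simp add: word_elem_def coxeter_group_def presented_group_mult)
qed

definition reduced_expression_for ::
    "'a set \<Rightarrow> ('a \<Rightarrow> 'a \<Rightarrow> enat) \<Rightarrow> ('a \<times> bool) list set \<Rightarrow> 'a list \<Rightarrow> bool" where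
  "reduced_expression_for S m w \<alpha> \<longleftrightarrow> \<alpha> \<in> lists S \<and> word_elem S m \<alpha> = w \<and>
    (\<forall>\<beta>\<in>lists S. word_elem S m \<beta> = w \<longrightarrow> length \<alpha> \<le> length \<beta>)"

definition reduced_expression :: "'a set \<Rightarrow> ('a \<Rightarrow> 'a \<Rightarrow> enat) \<Rightarrow> 'a list \<Rightarrow> bool" where
  "reduced_expression S m \<alpha> \<longleftrightarrow>
    (\<exists>w\<in>carrier (coxeter_group S m). reduced_expression_for S m w \<alpha>)"


section \<open>Braid graphs\<close>

definition braid_move :: "'a set \<Rightarrow> ('a \<Rightarrow> 'a \<Rightarrow> enat) \<Rightarrow> 'a list \<Rightarrow> 'a list \<Rightarrow> bool" where
  "braid_move S m \<alpha> \<beta> \<longleftrightarrow>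
    (\<exists>u v s t. s \<in> S \<and> t \<in> S \<and> m s t = 3 \<and> \<alpha> = u @ [s, t, s] @ v \<and> \<beta> = u @ [t, s, t] @ v)"

definition braid_class :: "'a set \<Rightarrow> ('a \<Rightarrow> 'a \<Rightarrow> enat) \<Rightarrow> 'a list \<Rightarrow> 'a list set" where
  "braid_class S m \<alpha> = {\<beta>. reduced_expression S m \<beta> \<and> (braid_move S m)\<^sup>*\<^sup>* \<alpha> \<beta>}"

definition braid_graph :: "'a set \<Rightarrow> ('a \<Rightarrow> 'a \<Rightarrow> enat) \<Rightarrow> 'a list \<Rightarrow> 'a list ugraph" where
  "braid_graph S m \<alpha> = (braid_class S m \<alpha>,
    {{\<beta>, \<gamma>} | \<beta> \<gamma>. \<beta> \<in> braid_class S m \<alpha> \<and> \<gamma> \<in> braid_class S m \<alpha> \<and> braid_move S m \<beta> \<gamma>})"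

end

theory Submission imports Defs begin

text \<open>
  A braid class embeds isometrically into a cube, with an image closed under coordinatewise
  majority, and such a graph is median.

  The coordinates come from the places where braid moves happen. Call \<open>i\<close> a site if some word of the
  class admits the move \<open>sts \<rightarrow> tst\<close> on the positions \<open>i, i + 1, i + 2\<close>; its centre is \<open>i + 1\<close>. The
  coordinate of a word at the site \<open>i\<close> is the letter at this centre. Three facts make this work.
  Two sites are never adjacent (\<open>sites_not_adjacent\<close>), so a move at \<open>i\<close> leaves all other centres
  alone and changes exactly one coordinate. If \<open>i\<close> and \<open>i + 2\<close> are both sites, no other move touches
  the positions \<open>i + 1, i + 2, i + 3\<close>, and since the Coxeter graph has no triangles, the three letters
  found there can be arranged in at most three ways (\<open>linked_triple\<close>). Hence every coordinate takes
  only two values and the coordinates determine the word. Finally, a move that would bring a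
  coordinate closer to its target can be blocked only by a neighbouring coordinate that also
  differs from its target, and blocking cannot go around in a circle, so some move towards the
  target is always possible (\<open>braid_towards\<close>).

  The last fact holds for every target any two of whose coordinates are attained together by some word
  of the class. A word of the class is such a target, which gives the isometry; so is the
  majority of three words, because two coordinates of it always agree with one of the three. The
  majority word is the median, and it is unique because in a cube the three intervals have only
  the majority in common.

  The Coxeter group enters through two facts: braid moves preserve reducedness
  (\<open>reduced_braid_move\<close>), and a reduced expression has no two equal letters in succession
  (\<open>reduced_no_square\<close>).
\<close>

section \<open>Median graphs from two-valued labellings\<close>

definition disagree :: "'i set \<Rightarrow> ('i \<Rightarrow> 'l) \<Rightarrow> ('i \<Rightarrow> 'l) \<Rightarrow> 'i set" where
  "disagree C x y = {i \<in> C. x i \<noteq> y i}"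

lemma finite_disagree: "finite C \<Longrightarrow> finite (disagree C x y)"
  by (simp add: disagree_def)

lemma card_disagree_triangle:
  assumes "finite C"
  shows "card (disagree C x z) \<le> card (disagree C x y) + card (disagree C y z)"
proof -
  have "disagree C x z \<subseteq> disagree C x y \<union> disagree C y z"
    by (auto simp: disagree_def)
  then have "card (disagree C x z) \<le> card (disagree C x y \<union> disagree C y z)"
    using assms by (intro card_mono) (auto simp: finite_disagree)
  also have "\<dots> \<le> card (disagree C x y) + card (disagree C y z)"
    by (rule card_Un_le)
  finally show ?thesis .
qed

text \<open>By \<open>two_labels\<close> each coordinate takes at most two values, so the labels place the vertices in a
  cube. The assumption \<open>approach\<close> is stated for all targets \<open>x\<close> that are realised on every pair of
  coordinates, because this is easy to check for a majority of labels, of which it is not clear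
  beforehand that it is itself the label of a vertex.\<close>
locale labelled_graph =
  fixes G :: "'v ugraph" and C :: "'i set" and f :: "'v \<Rightarrow> 'i \<Rightarrow> 'l"
  assumes simple: "simple_graph G"
    and finite_C: "finite C"
    and label_inj: "u \<in> fst G \<Longrightarrow> v \<in> fst G \<Longrightarrow> disagree C (f u) (f v) = {} \<Longrightarrow> u = v"
    and two_labels: "u \<in> fst G \<Longrightarrow> v \<in> fst G \<Longrightarrow> w \<in> fst G \<Longrightarrow> i \<in> C \<Longrightarrow>
      f u i = f v i \<or> f u i = f w i \<or> f v i = f w i"
    and edge_label: "{u, v} \<in> snd G \<Longrightarrow> card (disagree C (f u) (f v)) \<le> 1"
    and approach: "u \<in> fst G \<Longrightarrow> \<forall>i\<in>C. \<forall>j\<in>C. \<exists>w\<in>fst G. f w i = x i \<and> f w j = x j \<Longrightarrow>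
      disagree C (f u) x \<noteq> {} \<Longrightarrow>
      \<exists>v\<in>fst G. {u, v} \<in> snd G \<and> disagree C (f v) x \<subset> disagree C (f u) x"
begin

lemma walk_bound:
  assumes "walk G u p v"
  shows "card (disagree C (f u) (f v)) < length p"
  using assms
proof (induction p arbitrary: u)
  case Nil
  then show ?case by (simp add: walk_def)
next
  case (Cons a p)
  show ?case
  proof (cases p)
    case Nil
    then show ?thesis using Cons.prems by (auto simp: walk_def disagree_def)
  next
    case (Cons b q)
    have "walk G b p v" and e: "{u, b} \<in> snd G"
      using Cons.prems Cons by (auto simp: walk_def)
    then have "card (disagree C (f b) (f v)) < length p"
      using Cons.IH by blast
    moreover have "card (disagree C (f u) (f b)) \<le> 1"
      using e by (rule edge_label)
    ultimately show ?thesis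
      using card_disagree_triangle[OF finite_C, of "f u" "f v" "f b"] by simp
  qed
qed

text \<open>Taking \<open>x\<close> to be the label of a vertex gives geodesics; taking it to be a majority gives medians.\<close>
lemma walk_to_target:
  assumes "u \<in> fst G"
    and "\<forall>i\<in>C. \<forall>j\<in>C. \<exists>w\<in>fst G. f w i = x i \<and> f w j = x j"
  shows "\<exists>p v. walk G u p v \<and> length p \<le> Suc (card (disagree C (f u) x)) \<and>
    disagree C (f v) x = {}"
  using assms(1)
proof (induction "card (disagree C (f u) x)" arbitrary: u rule: less_induct)
  case less
  show ?case
  proof (cases "disagree C (f u) x = {}")
    case True
    have "walk G u [u] u" using less.prems by (simp add: walk_def)
    then show ?thesis using True by fastforce
  next
    case False
    obtain v where v: "v \<in> fst G" "{u, v} \<in> snd G"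
        and sub: "disagree C (f v) x \<subset> disagree C (f u) x"
      using approach[OF less.prems assms(2) False] by blast
    have lt: "card (disagree C (f v) x) < card (disagree C (f u) x)"
      using sub by (intro psubset_card_mono finite_disagree finite_C)
    obtain p y where p: "walk G v p y" "length p \<le> Suc (card (disagree C (f v) x))"
        "disagree C (f y) x = {}"
      using less.hyps[OF lt v(1)] by blast
    have "walk G u (u # p) y"
      using p(1) v less.prems by (cases p) (auto simp: walk_def)
    moreover have "length (u # p) \<le> Suc (card (disagree C (f u) x))"
      using p(2) lt by simp
    ultimately show ?thesis using p(3) by blast
  qed
qed

lemma walk_target_in:
  assumes "walk G u p v" shows "u \<in> fst G" "v \<in> fst G"
  using assms by (auto simp: walk_def)

lemma geodesic:
  assumes "u \<in> fst G" "v \<in> fst G"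
  shows "\<exists>p. walk G u p v \<and> length p = Suc (card (disagree C (f u) (f v)))"
proof -
  obtain p y where p: "walk G u p y" "length p \<le> Suc (card (disagree C (f u) (f v)))"
      "disagree C (f y) (f v) = {}"
    using walk_to_target[OF assms(1), of "f v"] assms(2) by blast
  have "y = v" using label_inj[OF walk_target_in(2)[OF p(1)] assms(2) p(3)] .
  then show ?thesis using p walk_bound[OF p(1)] by force
qed

lemma graph_dist_eq:
  assumes "u \<in> fst G" "v \<in> fst G"
  shows "graph_dist G u v = card (disagree C (f u) (f v))"
  unfolding graph_dist_def
proof (rule Least_equality)
  show "\<exists>p. walk G u p v \<and> length p = Suc (card (disagree C (f u) (f v)))"
    using geodesic[OF assms] .
qed (use walk_bound in force)

text \<open>The sum \<open>d(u,w) + d(w,v)\<close> exceeds \<open>d(u,v)\<close> by twice the number of coordinates in which \<open>w\<close> differs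
  from both \<open>u\<close> and \<open>v\<close>; as there are only two labels, \<open>u\<close> and \<open>v\<close> agree in these.\<close>
lemma interval_iff:
  assumes "u \<in> fst G" "v \<in> fst G" "w \<in> fst G"
  shows "w \<in> interval G u v \<longleftrightarrow> (\<forall>i\<in>C. f u i = f v i \<longrightarrow> f w i = f u i)"
proof -
  let ?D = "\<lambda>a b. disagree C (f a) (f b)"
  have fin: "finite (?D a b)" for a b by (rule finite_disagree[OF finite_C])
  have both: "?D u w \<inter> ?D w v \<inter> ?D u v = {}"
    using two_labels[OF assms] by (simp add: disagree_def set_eq_iff) metis
  have un: "?D u w \<union> ?D w v = ?D u v \<union> (?D u w \<inter> ?D w v)"
    by (auto simp: disagree_def)
  have "card (?D u w) + card (?D w v) = card (?D u w \<union> ?D w v) + card (?D u w \<inter> ?D w v)"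
    by (rule card_Un_Int[OF fin fin])
  also have "card (?D u w \<union> ?D w v) = card (?D u v) + card (?D u w \<inter> ?D w v)"
    unfolding un using both fin by (intro card_Un_disjoint) auto
  finally have "w \<in> interval G u v \<longleftrightarrow> card (?D u w \<inter> ?D w v) = 0"
    using assms by (simp add: interval_def graph_dist_eq)
  also have "\<dots> \<longleftrightarrow> ?D u w \<inter> ?D w v = {}"
    using fin by simp
  also have "\<dots> \<longleftrightarrow> (\<forall>i\<in>C. f u i = f v i \<longrightarrow> f w i = f u i)"
    using two_labels[OF assms] by (simp add: disagree_def set_eq_iff) metis
  finally show ?thesis .
qed

text \<open>In each coordinate two of three vertices agree, and a vertex in the interval of these two has
  their label. Thus a common vertex of the three intervals must carry the majority label.\<close>
theorem median: "median_graph G"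
  unfolding median_graph_def
proof (intro conjI ballI)
  show "connected_graph G"
    unfolding connected_graph_def using simple geodesic by blast
next
  fix u v w assume V: "u \<in> fst G" "v \<in> fst G" "w \<in> fst G"
  define maj where "maj i = (if f u i = f v i \<or> f u i = f w i then f u i else f v i)" for i
  \<comment> \<open>Each of \<open>i\<close> and \<open>j\<close> excludes at most one of \<open>u\<close>, \<open>v\<close>, \<open>w\<close>, so one of the three remains.\<close>
  have "\<exists>y\<in>fst G. f y i = maj i \<and> f y j = maj j" if "i \<in> C" "j \<in> C" for i j
  proof -
    have "(f u i = maj i \<and> f u j = maj j) \<or> (f v i = maj i \<and> f v j = maj j) \<or>
        (f w i = maj i \<and> f w j = maj j)"
      using two_labels[OF V that(1)] two_labels[OF V that(2)] unfolding maj_def by metis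
    then show ?thesis using V by blast
  qed
  then obtain p y where p: "walk G u p y" "disagree C (f y) maj = {}"
    using walk_to_target[OF V(1), of maj] by blast
  have y: "y \<in> fst G" by (rule walk_target_in(2)[OF p(1)])
  have ylab: "f y i = maj i" if "i \<in> C" for i
    using p(2) that by (auto simp: disagree_def)
  have iff: "z \<in> interval G u v \<inter> interval G u w \<inter> interval G v w \<longleftrightarrow> (\<forall>i\<in>C. f z i = maj i)"
    if z: "z \<in> fst G" for z
    unfolding Int_iff interval_iff[OF V(1,2) z] interval_iff[OF V(1,3) z] interval_iff[OF V(2,3) z]
      ball_conj_distrib[symmetric]
  proof (rule ball_cong)
    fix i assume "i \<in> C"
    from two_labels[OF V this]
    show "((f u i = f v i \<longrightarrow> f z i = f u i) \<and> (f u i = f w i \<longrightarrow> f z i = f u i)) \<and>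
        (f v i = f w i \<longrightarrow> f z i = f v i) \<longleftrightarrow> f z i = maj i"
      unfolding maj_def by auto
  qed simp
  have "interval G u v \<inter> interval G u w \<inter> interval G v w = {y}"
  proof (intro equalityI subsetI)
    fix z assume z: "z \<in> interval G u v \<inter> interval G u w \<inter> interval G v w"
    then have zV: "z \<in> fst G" by (simp add: interval_def)
    then have "disagree C (f z) (f y) = {}"
      using iff[OF zV] z ylab by (auto simp: disagree_def)
    then show "z \<in> {y}" using label_inj[OF zV y] by simp
  next
    fix z assume "z \<in> {y}"
    then show "z \<in> interval G u v \<inter> interval G u w \<inter> interval G v w"
      using iff[OF y] ylab by blast
  qed
  then show "card (interval G u v \<inter> interval G u w \<inter> interval G v w) = 1" by simp
qed

end


section \<open>Braid moves on sequences\<close>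

text \<open>Words are treated as total functions on positions, so that a move needs no bounds. The relation
  \<open>E\<close> stands for \<open>m(s,t) = 3\<close>, and the index of a move is its leftmost position.\<close>
definition braidable :: "('b \<Rightarrow> 'b \<Rightarrow> bool) \<Rightarrow> nat \<Rightarrow> (nat \<Rightarrow> 'b) \<Rightarrow> bool" where
  "braidable E i u \<longleftrightarrow> u i = u (i + 2) \<and> E (u i) (u (i + 1))"

lemma braidableD:
  assumes "braidable E i u"
  shows "u (i + 2) = u i" "E (u i) (u (i + 1))"
  using assms unfolding braidable_def by metis+

definition braid :: "nat \<Rightarrow> (nat \<Rightarrow> 'b) \<Rightarrow> nat \<Rightarrow> 'b" where
  "braid i u = u(i := u (i + 1), i + 1 := u i, i + 2 := u (i + 1))"

lemma braid_apply:
  "braid i u p = (if p = i \<or> p = i + 2 then u (i + 1) else if p = i + 1 then u i else u p)"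
  by (simp add: braid_def)

lemma braid_centre: "braid i u (i + 1) = u i"
  by (simp add: braid_def)

lemma braid_left: "braid i u i = u (i + 1)"
  by (simp add: braid_def)

definition braid_step :: "('b \<Rightarrow> 'b \<Rightarrow> bool) \<Rightarrow> (nat \<Rightarrow> 'b) \<Rightarrow> (nat \<Rightarrow> 'b) \<Rightarrow> bool" where
  "braid_step E u v \<longleftrightarrow> (\<exists>i. braidable E i u \<and> v = braid i u)"

text \<open>The degenerate case \<open>a = b = c\<close> of \<open>no_triangle\<close> says that \<open>E\<close> is irreflexive.\<close>
locale braid_family =
  fixes E :: "'b \<Rightarrow> 'b \<Rightarrow> bool" and X :: "(nat \<Rightarrow> 'b) set"
  assumes E_sym: "E a b \<Longrightarrow> E b a"
    and no_triangle: "E a b \<Longrightarrow> E b c \<Longrightarrow> \<not> E a c"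
    and closed: "u \<in> X \<Longrightarrow> braidable E i u \<Longrightarrow> braid i u \<in> X"
    and joined: "u \<in> X \<Longrightarrow> v \<in> X \<Longrightarrow> (braid_step E)\<^sup>*\<^sup>* u v"
    and square_free: "u \<in> X \<Longrightarrow> E (u i) b \<Longrightarrow> u (i + 1) \<noteq> u i"
begin

lemma braidable_braid: "braidable E i u \<Longrightarrow> braidable E i (braid i u)"
  by (auto simp: braidable_def braid_apply intro: E_sym)

lemma braid_braid: "braidable E i u \<Longrightarrow> braid i (braid i u) = u"
  by (auto simp: braidable_def braid_apply fun_eq_iff)

lemma braid_step_sym: "braid_step E u v \<Longrightarrow> braid_step E v u"
  unfolding braid_step_def using braidable_braid braid_braid by metis

text \<open>The move turns \<open>stst\<close> into \<open>tstt\<close>, which has a square.\<close>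
lemma no_alternation4:
  assumes "u \<in> X" "braidable E i u"
  shows "u (i + 3) \<noteq> u (i + 1)"
proof
  assume eq: "u (i + 3) = u (i + 1)"
  have "braid i u \<in> X" using assms by (rule closed)
  moreover have "E (u (i + 1)) (u i)"
    using assms(2) E_sym unfolding braidable_def by blast
  then have "E (braid i u (i + 2)) (u i)" by (simp add: braid_apply)
  ultimately have "braid i u (i + 2 + 1) \<noteq> braid i u (i + 2)"
    by (rule square_free)
  then show False using eq by (simp add: braid_apply numeral_3_eq_3)
qed

text \<open>Consider a shortest path between a word with \<open>sts\<close> at \<open>i\<close> and one with \<open>tst\<close> at \<open>i + 1\<close>. By
  minimality no two moves along it are at adjacent indices, and none is at an index adjacent to \<open>i\<close>
  or \<open>i + 1\<close>. So the path splits into moves far to the left and moves from \<open>i + 3\<close> on, which are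
  independent, and the letter at \<open>i + 3\<close> can become \<open>t\<close> only through a move at \<open>i + 3\<close>. No moves
  at \<open>i + 2\<close> or \<open>i + 4\<close> occur, so the positions \<open>i + 3, i + 4\<close> always carry the same two letters, one
  of which is \<open>t\<close>. Perform the moves on the right alone, up to a move at \<open>i + 3\<close>. If \<open>i + 3\<close> then
  carries \<open>t\<close>, the word contains \<open>stst\<close>. Otherwise it contains \<open>stsxtx\<close>, which the move at \<open>i\<close> turns into \<open>tstxtx\<close>, and this
  contains \<open>txtx\<close>. Both contradict \<open>no_alternation4\<close>.\<close>
lemma adjacent_sites_along_path:
  assumes "\<forall>j<k. braid_step E (x j) (x (Suc j))" "x 0 \<in> X" "braidable E i (x 0)"
  shows "\<not> braidable E (i + 1) (x k)"
  using assms
proof (induction k arbitrary: x i rule: less_induct)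
  case (less k)
  note path = less.prems(1) and x0 = less.prems(2) and bi = less.prems(3)
  show ?case
  proof
    assume bk: "braidable E (i + 1) (x k)"
    have xX: "x j \<in> X" if "j \<le> k" for j
      using that
    proof (induction j)
      case (Suc j)
      then show ?case using path closed by (auto simp: braid_step_def Suc_le_eq)
    qed (use x0 in simp)
    \<comment> \<open>The induction hypothesis on a proper segment of the path, which may be traversed backwards.\<close>
    have short: "\<not> braidable E (i' + 1) (x l)"
      if "braidable E i' (x j)" "j \<le> k" "l \<le> k" "l < j + k" "j < l + k" for i' j l
    proof (cases "j \<le> l")
      case True
      have "\<forall>n<l - j. braid_step E (x (j + n)) (x (j + Suc n))"
        using path that by auto
      then show ?thesis
        using less.IH[of "l - j" "\<lambda>n. x (j + n)" i'] that xX[of j] True by simp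
    next
      case False
      have "\<forall>n<j - l. braid_step E (x (j - n)) (x (j - Suc n))"
      proof (intro allI impI)
        fix n assume n: "n < j - l"
        then have "braid_step E (x (j - Suc n)) (x (Suc (j - Suc n)))"
          using path that by auto
        moreover have "Suc (j - Suc n) = j - n" using n by simp
        ultimately show "braid_step E (x (j - n)) (x (j - Suc n))"
          using braid_step_sym by metis
      qed
      then show ?thesis
        using less.IH[of "j - l" "\<lambda>n. x (j - n)" i'] that xX[of j] False by simp
    qed
    obtain d where d: "\<And>j. j < k \<Longrightarrow> braidable E (d j) (x j)"
        "\<And>j. j < k \<Longrightarrow> x (Suc j) = braid (d j) (x j)"
      using path unfolding braid_step_def by metis
    have d': "braidable E (d j) (x (Suc j))" if "j < k" for j
      using d[OF that] braidable_braid by simp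
    have d_far: "d j + 2 \<le> i \<or> i + 3 \<le> d j" if j: "j < k" for j
    proof -
      have "d j \<noteq> i + 1" using short[of i 0 j] bi d(1)[OF j] j by auto
      moreover have "i \<noteq> d j + 1" using short[of "d j" j 0] bi d(1)[OF j] j by auto
      moreover have "d j \<noteq> i" using short[of i "Suc j" k] bk d'[OF j] j by auto
      moreover have "d j \<noteq> i + 1 + 1" using short[of "i + 1" k "Suc j"] bk d'[OF j] j by auto
      ultimately show ?thesis by auto
    qed
    have mid: "x j (i + 1) = x 0 (i + 1) \<and> x j (i + 2) = x 0 (i + 2)" if "j \<le> k" for j
      using that
    proof (induction j)
      case (Suc j)
      then show ?case using d(2)[of j] d_far[of j] by (auto simp: braid_apply)
    qed simp
    have x0i: "x 0 (i + 2) = x 0 i" "E (x 0 i) (x 0 (i + 1))"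
      using braidableD[OF bi] by blast+
    have xk: "x k (i + 3) = x 0 (i + 1)"
      using bk mid[of k] by (simp add: braidable_def numeral_3_eq_3)
    have "\<exists>j<k. d j = i + 3"
    proof (rule ccontr)
      assume no: "\<not> (\<exists>j<k. d j = i + 3)"
      have "x j (i + 3) = x 0 (i + 3)" if "j \<le> k" for j
        using that
      proof (induction j)
        case (Suc j)
        then have "d j \<noteq> i + 3" using no by auto
        then show ?case using Suc d(2)[of j] d_far[of j] by (auto simp: braid_apply)
      qed simp
      then have "x k (i + 3) = x 0 (i + 3)" by blast
      then show False using xk no_alternation4[OF x0 bi] by metis
    qed
    then obtain j where j: "j < k" "d j = i + 3" by blast
    have d_ne: "d l \<noteq> i + 4" if l: "l < k" for l
    proof
      assume "d l = i + 4"
      moreover have "i + 4 = i + 3 + 1" by simp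
      ultimately have "braidable E (i + 3 + 1) (x l)" using d(1)[OF l] by metis
      then show False using short[of "i + 3" j l] d(1)[OF j(1)] j l by simp
    qed
    have pair: "{x l (i + 3), x l (i + 4)} = {x 0 (i + 3), x 0 (i + 4)}" if "l \<le> k" for l
      using that
    proof (induction l)
      case (Suc l)
      then have l: "l < k" and IH: "{x l (i + 3), x l (i + 4)} = {x 0 (i + 3), x 0 (i + 4)}"
        by auto
      have "x (Suc l) (i + 3) = x l (i + 4) \<and> x (Suc l) (i + 4) = x l (i + 3) \<or>
          x (Suc l) (i + 3) = x l (i + 3) \<and> x (Suc l) (i + 4) = x l (i + 4)"
      proof (cases "d l = i + 3")
        case True
        moreover have "i + 4 = i + 3 + 1" by simp
        ultimately show ?thesis using d(2)[OF l] by (metis braid_centre braid_left)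
      next
        case False
        then have "d l + 2 \<le> i \<or> i + 5 \<le> d l" using d_far[OF l] d_ne[OF l] by linarith
        then show ?thesis using d(2)[OF l] by (auto simp: braid_apply)
      qed
      then show ?case using IH by (auto simp: doubleton_eq_iff)
    qed simp
    \<comment> \<open>The word \<open>y l\<close> results from \<open>x 0\<close> by those of the first \<open>l\<close> moves that lie on the right.\<close>
    define y where "y l p = (if p \<ge> i + 3 then x l p else x 0 p)" for l p
    have yX: "y l \<in> X" if "l \<le> k" for l
      using that
    proof (induction l)
      case 0
      have "y 0 = x 0" by (auto simp: y_def)
      then show ?case using x0 by simp
    next
      case (Suc l)
      then have l: "l < k" and yl: "y l \<in> X" by auto
      show ?case
      proof (cases "d l \<ge> i + 3")
        case True
        then have "braidable E (d l) (y l)" "y (Suc l) = braid (d l) (y l)"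
          using d[OF l] by (auto simp: y_def braidable_def braid_apply fun_eq_iff)
        then show ?thesis using closed[OF yl] by simp
      next
        case False
        then have "y (Suc l) = y l"
          using d[OF l] d_far[OF l] by (auto simp: y_def braid_apply fun_eq_iff)
        then show ?thesis using yl by simp
      qed
    qed
    have yj: "y j \<in> X" using yX j by simp
    have biy: "braidable E i (y j)" using x0i by (simp add: y_def braidable_def)
    have low: "y j i = x 0 i" "y j (i + 1) = x 0 (i + 1)" "y j (i + 2) = x 0 i"
      using x0i by (simp_all add: y_def)
    have "x 0 (i + 1) \<in> {x j (i + 3), x j (i + 4)}"
      using pair[of k] pair[of j] xk j by auto
    then have "x 0 (i + 1) \<in> {y j (i + 3), y j (i + 4)}" by (simp add: y_def)
    moreover have "y j (i + 3) \<noteq> x 0 (i + 1)"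
      using no_alternation4[OF yj biy] low by simp
    ultimately have y4: "y j (i + 4) = x 0 (i + 1)" by auto
    have "y j (i + 3) = x j (i + 3)" "y j (i + 3 + 1) = x j (i + 3 + 1)"
        "y j (i + 3 + 2) = x j (i + 3 + 2)"
      by (simp_all add: y_def)
    then have "braidable E (i + 3) (y j)"
      using d(1)[OF j(1)] j(2) unfolding braidable_def by metis
    from braidableD[OF this] have y5: "y j (i + 5) = y j (i + 3)" "E (y j (i + 3)) (x 0 (i + 1))"
      using y4 by (simp_all add: algebra_simps)
    \<comment> \<open>From position \<open>i\<close> on, \<open>y j\<close> reads \<open>stsxtx\<close>, and \<open>?z\<close> reads \<open>tstxtx\<close>.\<close>
    let ?z = "braid i (y j)"
    have z: "?z \<in> X" using closed[OF yj biy] .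
    have zl: "?z (i + 2) = x 0 (i + 1)" "?z (i + 3) = y j (i + 3)" "?z (i + 4) = x 0 (i + 1)"
        "?z (i + 5) = y j (i + 3)"
      using low y4 y5 by (simp_all add: braid_apply)
    have "braidable E (i + 2) ?z"
      using zl E_sym[OF y5(2)] by (simp add: braidable_def numeral_eq_Suc)
    from no_alternation4[OF z this] zl show False by (simp add: numeral_eq_Suc)
  qed
qed

definition sites :: "nat set" where
  "sites = {i. \<exists>u\<in>X. braidable E i u}"

lemma sites_not_adjacent:
  assumes "i \<in> sites" shows "i + 1 \<notin> sites"
proof
  assume "i + 1 \<in> sites"
  then obtain v where v: "v \<in> X" "braidable E (i + 1) v" by (auto simp: sites_def)
  obtain u where u: "u \<in> X" "braidable E i u" using assms by (auto simp: sites_def)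
  obtain k where "(braid_step E ^^ k) u v"
    using joined[OF u(1) v(1)] by (auto dest: rtranclp_imp_relpowp)
  then obtain x where "x 0 = u" "x k = v" "\<forall>j<k. braid_step E (x j) (x (Suc j))"
    by (auto simp: relpowp_fun_conv)
  then show False using adjacent_sites_along_path[of k x i] u v by simp
qed

lemma family_induct [consumes 2, case_names start step]:
  assumes "u \<in> X" "v \<in> X" "P u"
    and step: "\<And>w i. w \<in> X \<Longrightarrow> i \<in> sites \<Longrightarrow> braidable E i w \<Longrightarrow> P w \<Longrightarrow> P (braid i w)"
  shows "P v"
proof -
  have "v \<in> X \<and> P v"
    using joined[OF assms(1,2)]
  proof (induction rule: rtranclp_induct)
    case base
    then show ?case using assms by simp
  next
    case (step y z)
    then obtain i where i: "braidable E i y" "z = braid i y" by (auto simp: braid_step_def)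
    then show ?case using step.IH closed assms(4)[of y i] by (auto simp: sites_def)
  qed
  then show ?thesis ..
qed

lemma untouched_letter:
  assumes "u \<in> X" "v \<in> X" "\<And>i. i \<in> sites \<Longrightarrow> p \<notin> {i, i + 1, i + 2}"
  shows "v p = u p"
  using assms(1,2)
proof (induction rule: family_induct)
  case (step w i)
  then show ?case using assms(3)[of i] by (simp add: braid_apply)
qed simp

text \<open>Moves at \<open>i\<close> only exchange the two letters, and no other move reaches them.\<close>
lemma right_pair:
  assumes "u \<in> X" "v \<in> X" "i \<in> sites" "i + 2 \<notin> sites"
  shows "{v (i + 1), v (i + 2)} = {u (i + 1), u (i + 2)}"
  using assms(1,2)
proof (induction rule: family_induct)
  case (step w j)
  have ne: "j \<noteq> i + 1" "i \<noteq> j + 1" "j \<noteq> i + 2"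
    using sites_not_adjacent assms(3,4) step(2) by metis+
  show ?case
  proof (cases "j = i")
    case True
    then have "w i = w (i + 2)" using step(3) by (simp add: braidable_def)
    then have "braid j w (i + 1) = w (i + 2)" "braid j w (i + 2) = w (i + 1)"
      using True by (simp_all add: braid_def)
    then show ?thesis using step(4) by (auto simp: doubleton_eq_iff)
  next
    case False
    then have "braid j w (i + 1) = w (i + 1)" "braid j w (i + 2) = w (i + 2)"
      using ne by (auto simp: braid_apply)
    then show ?thesis using step(4) by metis
  qed
qed simp

lemma left_pair:
  assumes "u \<in> X" "v \<in> X" "i \<in> sites" "\<And>j. i = j + 2 \<Longrightarrow> j \<notin> sites"
  shows "{v i, v (i + 1)} = {u i, u (i + 1)}"
  using assms(1,2)
proof (induction rule: family_induct)
  case (step w j)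
  have ne: "j \<noteq> i + 1" "i \<noteq> j + 1" "i \<noteq> j + 2"
    using sites_not_adjacent assms(3,4) step(2) by metis+
  show ?case
  proof (cases "j = i")
    case True
    then have "braid j w i = w (i + 1)" "braid j w (i + 1) = w i"
      by (simp_all add: braid_def)
    then show ?thesis using step(4) by (auto simp: doubleton_eq_iff)
  next
    case False
    then have "braid j w i = w i" "braid j w (i + 1) = w (i + 1)"
      using ne by (auto simp: braid_apply)
    then show ?thesis using step(4) by metis
  qed
qed simp

text \<open>Only the moves at \<open>i\<close> and \<open>i + 2\<close> touch the positions \<open>i + 1, i + 2, i + 3\<close>; they exchange the
  first two or the last two of the three letters, if these are related by \<open>E\<close>. Start with \<open>a, b\<close> related
  in front of \<open>c\<close>. Bringing \<open>c\<close> to the middle requires \<open>c\<close> to be related to the letter that moves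
  behind it; bringing \<open>c\<close> on to the front would require it to be related to the other letter too,
  and \<open>a, b, c\<close> would be a triangle.\<close>
lemma linked_triple:
  assumes "i \<in> sites" "i + 2 \<in> sites"
  shows "\<exists>a b c. E a b \<and> c \<noteq> a \<and> c \<noteq> b \<and> (\<forall>v\<in>X.
      v (i + 3) = c \<and> {v (i + 1), v (i + 2)} = {a, b} \<or>
      v (i + 2) = c \<and> {v (i + 1), v (i + 3)} = {a, b} \<and> E c (v (i + 3)))"
proof -
  obtain u where u: "u \<in> X" "braidable E i u" using assms(1) by (auto simp: sites_def)
  let ?a = "u (i + 2)" and ?b = "u (i + 1)" and ?c = "u (i + 3)"
  have ab: "E ?a ?b" using braidableD[OF u(2)] by metis
  have ca: "?c \<noteq> ?a" using square_free[OF u(1) ab] by (simp add: numeral_3_eq_3)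
  have cb: "?c \<noteq> ?b" by (rule no_alternation4[OF u])
  have "v (i + 3) = ?c \<and> {v (i + 1), v (i + 2)} = {?a, ?b} \<or>
      v (i + 2) = ?c \<and> {v (i + 1), v (i + 3)} = {?a, ?b} \<and> E ?c (v (i + 3))" if "v \<in> X" for v
    using u(1) that
  proof (induction rule: family_induct)
    case start
    then show ?case by auto
  next
    case (step w j)
    have "j \<noteq> i + 1" "j \<noteq> i + 3" "i \<noteq> j + 1"
      using sites_not_adjacent[of i] sites_not_adjacent[of "i + 2"] sites_not_adjacent[of j]
        assms step(2) by (auto simp: numeral_3_eq_3)
    then consider "j = i" | "j = i + 2" | "j + 2 \<le> i" | "j \<ge> i + 4" by linarith
    then show ?case
    proof cases
      case 1
      have E: "E (w (i + 1)) (w (i + 2))" using braidableD[OF step(3)] 1 E_sym by metis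
      have "\<not> ({w (i + 1), w (i + 3)} = {?a, ?b} \<and> E ?c (w (i + 3)))" if "w (i + 2) = ?c"
        using no_triangle[of "w (i + 1)" ?c "w (i + 3)"] E that ab E_sym[OF ab]
        by (auto simp: doubleton_eq_iff)
      then have "w (i + 3) = ?c" "{w (i + 1), w (i + 2)} = {?a, ?b}" using step(4) by auto
      moreover have "braid i w (i + 1) = w (i + 2)" "braid i w (i + 2) = w (i + 1)"
          "braid i w (i + 3) = w (i + 3)"
        using step(3) 1 by (simp_all add: braid_apply braidable_def)
      ultimately show ?thesis using 1 by (auto simp: doubleton_eq_iff)
    next
      case 2
      have E: "E (w (i + 2)) (w (i + 3))"
        using braidableD(2)[OF step(3)] 2 by (simp add: numeral_3_eq_3)
      have "braid (i + 2) w (i + 1) = w (i + 1)" "braid (i + 2) w (i + 2) = w (i + 3)"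
          "braid (i + 2) w (i + 3) = w (i + 2)"
        by (simp_all add: braid_apply numeral_3_eq_3)
      then show ?thesis using step(4) E_sym[OF E] 2 by metis
    next
      case 3
      then show ?thesis using step(4) by (simp add: braid_apply)
    next
      case 4
      then show ?thesis using step(4) by (simp add: braid_apply)
    qed
  qed
  then show ?thesis using ab ca cb by blast
qed

lemma centre_pair:
  assumes "i \<in> sites"
  obtains a b where "E a b" "\<And>v. v \<in> X \<Longrightarrow> v (i + 1) \<in> {a, b}"
proof (cases "i + 2 \<in> sites")
  case True
  from linked_triple[OF assms this] obtain a b c where ab: "E a b" and "c \<noteq> a" "c \<noteq> b"
    and *: "\<forall>v\<in>X.
      v (i + 3) = c \<and> {v (i + 1), v (i + 2)} = {a, b} \<or>
      v (i + 2) = c \<and> {v (i + 1), v (i + 3)} = {a, b} \<and> E c (v (i + 3))" by (elim exE conjE) (rule that)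
  have "v (i + 1) \<in> {a, b}" if "v \<in> X" for v using bspec[OF * that] by blast
  then show ?thesis using that ab by blast
next
  case False
  obtain u where u: "u \<in> X" "braidable E i u" using assms by (auto simp: sites_def)
  have "E (u (i + 1)) (u (i + 2))" using braidableD[OF u(2)] E_sym by metis
  moreover have "v (i + 1) \<in> {u (i + 1), u (i + 2)}" if "v \<in> X" for v
    using right_pair[OF u(1) that assms False] by blast
  ultimately show ?thesis using that by blast
qed

lemma centres_bonded:
  assumes "i \<in> sites" "u \<in> X" "v \<in> X" "u (i + 1) \<noteq> v (i + 1)"
  shows "E (v (i + 1)) (u (i + 1))"
proof -
  obtain a b where ab: "E a b" and mem: "\<And>v. v \<in> X \<Longrightarrow> v (i + 1) \<in> {a, b}"
    using centre_pair[OF assms(1)] by blast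
  show ?thesis using mem[OF assms(2)] mem[OF assms(3)] assms(4) ab E_sym[OF ab] by auto
qed

text \<open>A word \<open>u\<close> whose centre of the site \<open>i\<close> should change to the letter of \<open>w\<close> cannot make this move
  if the letter at \<open>i + 2\<close> is the wrong one. Then \<open>c\<close> is in the middle of the triple of \<open>u\<close>, but last in
  that of \<open>w\<close>: so the next site differs as well, and on its left side it is ready for the
  move towards \<open>w\<close>.\<close>
lemma blocked_on_right:
  assumes sites: "i \<in> sites" "i + 2 \<in> sites" and X: "u \<in> X" "w \<in> X"
    and differ: "u (i + 1) \<noteq> w (i + 1)" and blocked: "u (i + 2) \<noteq> w (i + 1)"
  shows "u (i + 3) \<noteq> w (i + 3)" "u (i + 2) = w (i + 3)"
proof -
  from linked_triple[OF sites] obtain a b c where ab: "E a b" and c: "c \<noteq> a" "c \<noteq> b"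
    and *: "\<forall>v\<in>X.
      v (i + 3) = c \<and> {v (i + 1), v (i + 2)} = {a, b} \<or>
      v (i + 2) = c \<and> {v (i + 1), v (i + 3)} = {a, b} \<and> E c (v (i + 3))" by (elim exE conjE) (rule that)
  have w1: "w (i + 1) \<in> {a, b}" using bspec[OF * X(2)] by blast
  have u: "u (i + 2) = c" "{u (i + 1), u (i + 3)} = {a, b}" "E c (u (i + 3))"
    using bspec[OF * X(1)] w1 differ blocked by (auto simp: doubleton_eq_iff)
  have "w (i + 3) = c"
  proof (rule ccontr)
    assume "w (i + 3) \<noteq> c"
    then have "{w (i + 1), w (i + 3)} = {a, b}" "E c (w (i + 3))" using bspec[OF * X(2)] by blast+
    then have "E c a" "E c b" using u differ by (auto simp: doubleton_eq_iff)
    then show False using no_triangle ab by blast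
  qed
  then show "u (i + 3) \<noteq> w (i + 3)" "u (i + 2) = w (i + 3)"
    using u c by (auto simp: doubleton_eq_iff)
qed

text \<open>The multiset of the three letters is invariant.\<close>
lemma linked_last_two:
  assumes sites: "i \<in> sites" "i + 2 \<in> sites" and X: "u \<in> X" "w \<in> X"
    and eq: "u (i + 1) = w (i + 1)"
  shows "u (i + 2) = w (i + 2) \<and> u (i + 3) = w (i + 3) \<or>
    u (i + 2) = w (i + 3) \<and> u (i + 3) = w (i + 2)"
proof -
  from linked_triple[OF sites] obtain a b c where "E a b" and c: "c \<noteq> a" "c \<noteq> b"
    and *: "\<forall>v\<in>X.
      v (i + 3) = c \<and> {v (i + 1), v (i + 2)} = {a, b} \<or>
      v (i + 2) = c \<and> {v (i + 1), v (i + 3)} = {a, b} \<and> E c (v (i + 3))" by (elim exE conjE) (rule that)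
  show ?thesis
    using bspec[OF * X(1)] bspec[OF * X(2)] eq c unfolding doubleton_eq_iff by metis
qed

text \<open>A position next to a single centre takes the remaining letter of its invariant pair, a position
  between two centres the remaining letter of its invariant triple, and any other position
  outside the centres never changes.\<close>
lemma determined_by_centres:
  assumes X: "u \<in> X" "w \<in> X" and eq: "\<And>i. i \<in> sites \<Longrightarrow> u (i + 1) = w (i + 1)"
  shows "u = w"
proof
  fix p
  have linked: "u (i + 2) = w (i + 2)" if "i \<in> sites" "i + 2 \<in> sites" for i
  proof -
    have "i + 3 = i + 2 + 1" by simp
    then have "u (i + 3) = w (i + 3)" using eq[OF that(2)] by metis
    then show ?thesis using linked_last_two[OF that X eq[OF that(1)]] by metis
  qed
  show "u p = w p"
  proof (cases "\<exists>i\<in>sites. p \<in> {i, i + 1, i + 2}")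
    case False
    then show ?thesis using untouched_letter[OF X] by metis
  next
    case True
    then obtain i where i: "i \<in> sites" and p: "p = i \<or> p = i + 1 \<or> p = i + 2" by blast
    show ?thesis
      using p
    proof (elim disjE)
      assume p: "p = i"
      show ?thesis
      proof (cases "\<exists>j\<in>sites. i = j + 2")
        case True
        then show ?thesis using linked p i by blast
      next
        case False
        then have "{w i, w (i + 1)} = {u i, u (i + 1)}" using left_pair[OF X i] by blast
        then show ?thesis using p eq[OF i] by (auto simp: doubleton_eq_iff)
      qed
    next
      assume "p = i + 1"
      then show ?thesis using eq[OF i] by simp
    next
      assume p: "p = i + 2"
      show ?thesis
      proof (cases "i + 2 \<in> sites")
        case True
        then show ?thesis using linked p i by blast
      next
        case False
        then have "{w (i + 1), w (i + 2)} = {u (i + 1), u (i + 2)}" using right_pair[OF X i] by blast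
        then show ?thesis using p eq[OF i] by (auto simp: doubleton_eq_iff)
      qed
    qed
  qed
qed

text \<open>Among the sites where \<open>u\<close> misses the target, the leftmost is not blocked on the left: if it shares
  a triple with the preceding site, this triple already has the right letter at that site's
  centre. Take the rightmost site where \<open>u\<close> misses the target and that is not blocked on the left.
  If it were blocked on the right, then by \<open>blocked_on_right\<close> the next site would also miss the target and be free on the left.\<close>
lemma braid_towards:
  assumes fin: "finite sites" and u: "u \<in> X"
    and real: "\<And>i j. i \<in> sites \<Longrightarrow> j \<in> sites \<Longrightarrow> \<exists>w\<in>X. w (i + 1) = x i \<and> w (j + 1) = x j"
    and differ: "\<exists>i\<in>sites. u (i + 1) \<noteq> x i"
  shows "\<exists>i\<in>sites. braidable E i u \<and> u (i + 1) \<noteq> x i \<and> u i = x i"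
proof -
  define D where "D = {i \<in> sites. u (i + 1) \<noteq> x i}"
  define F where "F = {i \<in> D. u i = x i}"
  have finD: "finite D" and finF: "finite F" using fin by (simp_all add: D_def F_def)
  have "D \<noteq> {}" using differ by (auto simp: D_def)
  define k where "k = Min D"
  have kD: "k \<in> D" unfolding k_def using finD \<open>D \<noteq> {}\<close> by (rule Min_in)
  then have k: "k \<in> sites" "u (k + 1) \<noteq> x k" by (auto simp: D_def)
  have "u k = x k"
  proof (cases "\<exists>j\<in>sites. k = j + 2")
    case True
    then obtain j where j: "j \<in> sites" "k = j + 2" by blast
    have "j \<notin> D"
    proof
      assume "j \<in> D"
      then have "k \<le> j" unfolding k_def by (intro Min_le finD)
      then show False using j by simp
    qed
    then have uj: "u (j + 1) = x j" using j by (simp add: D_def)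
    obtain w where w: "w \<in> X" "w (j + 1) = x j" "w (k + 1) = x k" using real[OF j(1) k(1)] by blast
    have k1: "k + 1 = j + 3" using j by simp
    have "j + 2 \<in> sites" using k(1) j(2) by metis
    moreover have "u (j + 1) = w (j + 1)" using uj w by simp
    ultimately have "u (j + 2) = w (j + 2) \<and> u (j + 3) = w (j + 3) \<or>
        u (j + 2) = w (j + 3) \<and> u (j + 3) = w (j + 2)"
      using linked_last_two[OF j(1) _ u w(1)] by blast
    then show ?thesis using k(2) w(3) j(2) k1 by metis
  next
    case False
    obtain w where w: "w \<in> X" "w (k + 1) = x k" using real[OF k(1) k(1)] by blast
    have "{w k, w (k + 1)} = {u k, u (k + 1)}" using left_pair[OF u w(1) k(1)] False by blast
    then show ?thesis using k(2) w(2) by (auto simp: doubleton_eq_iff)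
  qed
  then have "F \<noteq> {}" using kD by (auto simp: F_def)
  define i where "i = Max F"
  have "i \<in> F" unfolding i_def using finF \<open>F \<noteq> {}\<close> by (rule Max_in)
  then have i: "i \<in> sites" "u (i + 1) \<noteq> x i" "u i = x i" by (auto simp: F_def D_def)
  obtain w where w: "w \<in> X" "w (i + 1) = x i" using real[OF i(1) i(1)] by blast
  have "u (i + 2) = x i"
  proof (rule ccontr)
    assume blocked: "u (i + 2) \<noteq> x i"
    show False
    proof (cases "i + 2 \<in> sites")
      case True
      obtain w' where w': "w' \<in> X" "w' (i + 1) = x i" "w' (i + 2 + 1) = x (i + 2)"
        using real[OF i(1) True] by blast
      have "u (i + 3) \<noteq> w' (i + 3)" "u (i + 2) = w' (i + 3)"
        using blocked_on_right[OF i(1) True u w'(1)] w'(2) i(2) blocked by metis+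
      then have "i + 2 \<in> F" unfolding F_def D_def using True w'(3) by (simp add: numeral_3_eq_3)
      then have "i + 2 \<le> i" unfolding i_def by (intro Max_ge finF)
      then show False by simp
    next
      case False
      have "{w (i + 1), w (i + 2)} = {u (i + 1), u (i + 2)}"
        by (rule right_pair[OF u w(1) i(1) False])
      then show False using w(2) i(2) blocked by (auto simp: doubleton_eq_iff)
    qed
  qed
  moreover have "E (x i) (u (i + 1))" using centres_bonded[OF i(1) u w(1)] w(2) i(2) by metis
  ultimately have "braidable E i u" using i(3) by (simp add: braidable_def)
  then show ?thesis using i by blast
qed

lemma braid_other_centre:
  assumes "i \<in> sites" "j \<in> sites" "j \<noteq> i"
  shows "braid i u (j + 1) = u (j + 1)"
proof -
  have "j \<noteq> i + 1" "i \<noteq> j + 1" using sites_not_adjacent assms by metis+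
  then show ?thesis using assms(3) by (simp add: braid_apply)
qed

end


section \<open>Braid moves between reduced expressions\<close>

text \<open>Positions beyond the end of the word carry \<open>None\<close>, which \<open>bond\<close> relates to nothing, so no move
  reaches them.\<close>
definition word_fun :: "'a list \<Rightarrow> nat \<Rightarrow> 'a option" where
  "word_fun \<beta> i = (if i < length \<beta> then Some (\<beta> ! i) else None)"

definition bond :: "'a set \<Rightarrow> ('a \<Rightarrow> 'a \<Rightarrow> enat) \<Rightarrow> 'a option \<Rightarrow> 'a option \<Rightarrow> bool" where
  "bond S m a b \<longleftrightarrow> (\<exists>s\<in>S. \<exists>t\<in>S. a = Some s \<and> b = Some t \<and> m s t = 3)"

lemma inj_word_fun: "inj word_fun"
proof (rule injI)
  fix \<beta> \<gamma> :: "'a list" assume eq: "word_fun \<beta> = word_fun \<gamma>"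
  have iff: "i < length \<beta> \<longleftrightarrow> i < length \<gamma>" for i
    using fun_cong[OF eq, of i] by (auto simp: word_fun_def split: if_splits)
  then have "length \<beta> = length \<gamma>" by (metis less_irrefl linorder_neqE_nat)
  then show "\<beta> = \<gamma>"
  proof (rule nth_equalityI)
    fix i assume "i < length \<beta>"
    then show "\<beta> ! i = \<gamma> ! i" using fun_cong[OF eq, of i] iff by (simp add: word_fun_def)
  qed
qed

lemma word_fun_append:
  "word_fun (\<beta> @ \<gamma>) i = (if i < length \<beta> then word_fun \<beta> i else word_fun \<gamma> (i - length \<beta>))"
  by (auto simp: word_fun_def nth_append)

lemma word_fun_Cons: "word_fun (a # \<beta>) i = (case i of 0 \<Rightarrow> Some a | Suc j \<Rightarrow> word_fun \<beta> j)"
  by (auto simp: word_fun_def split: nat.split)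

lemma word_fun_braid:
  "word_fun (\<beta> @ [t, s, t] @ \<gamma>) = braid (length \<beta>) (word_fun (\<beta> @ [s, t, s] @ \<gamma>))"
proof
  fix p
  have "p < length \<beta> \<or> p = length \<beta> \<or> p = length \<beta> + 1 \<or> p = length \<beta> + 2 \<or>
      p = length \<beta> + (p - length \<beta> - 3 + 3)"
    by arith
  then consider "p < length \<beta>" | "p = length \<beta>" | "p = length \<beta> + 1" | "p = length \<beta> + 2"
    | q where "p = length \<beta> + (q + 3)"
    by blast
  then show "word_fun (\<beta> @ [t, s, t] @ \<gamma>) p = braid (length \<beta>) (word_fun (\<beta> @ [s, t, s] @ \<gamma>)) p"
    by cases (simp_all add: braid_apply word_fun_append word_fun_Cons numeral_3_eq_3)
qed

lemma braidable_word_fun: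
  assumes "braidable (bond S m) i (word_fun \<beta>)"
  obtains \<gamma> where "braid_move S m \<beta> \<gamma>" "word_fun \<gamma> = braid i (word_fun \<beta>)" "i < length \<beta>"
proof -
  obtain s t where st: "s \<in> S" "t \<in> S" "m s t = 3"
    and w: "word_fun \<beta> i = Some s" "word_fun \<beta> (i + 1) = Some t" "word_fun \<beta> (i + 2) = Some s"
    using braidableD[OF assms] unfolding bond_def by metis
  have len: "i + 2 < length \<beta>" and nth: "\<beta> ! i = s" "\<beta> ! (i + 1) = t" "\<beta> ! (i + 2) = s"
    using w by (auto simp: word_fun_def split: if_splits)
  have "drop i \<beta> = [s, t, s] @ drop (i + 3) \<beta>"
    using len nth by (simp add: Cons_nth_drop_Suc[symmetric] numeral_3_eq_3)
  then have \<beta>: "\<beta> = take i \<beta> @ [s, t, s] @ drop (i + 3) \<beta>" by (metis append_take_drop_id)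
  let ?\<gamma> = "take i \<beta> @ [t, s, t] @ drop (i + 3) \<beta>"
  have "braid_move S m \<beta> ?\<gamma>" unfolding braid_move_def using st \<beta> by blast
  moreover have "word_fun ?\<gamma> = braid i (word_fun \<beta>)"
    using word_fun_braid[of "take i \<beta>" t s "drop (i + 3) \<beta>"] \<beta> len by simp
  ultimately show ?thesis using that len by simp
qed

lemma braid_move_word_fun:
  assumes "braid_move S m \<beta> \<gamma>"
  obtains i where "braidable (bond S m) i (word_fun \<beta>)" "word_fun \<gamma> = braid i (word_fun \<beta>)"
proof -
  obtain u v s t where st: "s \<in> S" "t \<in> S" "m s t = 3"
    and \<beta>: "\<beta> = u @ [s, t, s] @ v" and \<gamma>: "\<gamma> = u @ [t, s, t] @ v"
    using assms unfolding braid_move_def by blast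
  have "braidable (bond S m) (length u) (word_fun \<beta>)"
    using st by (simp add: \<beta> braidable_def bond_def word_fun_append word_fun_Cons)
  then show ?thesis using that word_fun_braid \<beta> \<gamma> by metis
qed

lemma square_pres_rel:
  assumes "coxeter_matrix S m" "s \<in> S"
  shows "([(s, True), (s, True)], []) \<in> pres_rel S (coxeter_relators S m)"
proof -
  have "m s s = enat 1" using assms by (simp add: coxeter_matrix_def one_enat_def)
  then have "concat (replicate 1 [(s, True), (s, True)]) \<in> coxeter_relators S m"
    unfolding coxeter_relators_def using assms(2) by blast
  then show ?thesis
    using pres_rel.relator[of "[]" S "[]" "[(s, True), (s, True)]"] assms(2)
    by (simp add: signed_words_def)
qed

text \<open>Insert \<open>tst tst\<close>, which cancels, behind \<open>sts\<close> and delete the relator \<open>(st)\<^sup>3\<close>.\<close>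
lemma braid_pres_rel:
  assumes "coxeter_matrix S m" "s \<in> S" "t \<in> S" "m s t = 3"
  shows "([(s, True), (t, True), (s, True)], [(t, True), (s, True), (t, True)])
    \<in> pres_rel S (coxeter_relators S m)"
proof -
  let ?R = "pres_rel S (coxeter_relators S m)"
  let ?s = "(s, True)" and ?t = "(t, True)"
  have words: "set w \<subseteq> {?s, ?t} \<Longrightarrow> w \<in> signed_words S" for w
    using assms(2,3) by (auto simp: signed_words_def in_lists_conv_set)
  have "m s t = enat 3" using assms(4) by (simp add: numeral_eq_enat)
  then have "concat (replicate 3 [?s, ?t]) \<in> coxeter_relators S m"
    unfolding coxeter_relators_def using assms(2,3) by blast
  then have rel: "([?s, ?t, ?s, ?t, ?s, ?t] @ [?t, ?s, ?t], [?t, ?s, ?t]) \<in> ?R"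
    using pres_rel.relator[of "[]" S "[?t, ?s, ?t]" "[?s, ?t, ?s, ?t, ?s, ?t]"] words
    by (simp add: numeral_3_eq_3)
  have "([?s, ?t, ?s, ?t, ?s] @ [?t, ?t] @ [?s, ?t], [?s, ?t, ?s, ?t, ?s] @ [] @ [?s, ?t]) \<in> ?R"
    using square_pres_rel[OF assms(1,3)] by (rule pres_rel_context) (simp_all add: words)
  moreover have "([?s, ?t, ?s, ?t] @ [?s, ?s] @ [?t], [?s, ?t, ?s, ?t] @ [] @ [?t]) \<in> ?R"
    using square_pres_rel[OF assms(1,2)] by (rule pres_rel_context) (simp_all add: words)
  moreover have "([?s, ?t, ?s] @ [?t, ?t] @ [], [?s, ?t, ?s] @ [] @ []) \<in> ?R"
    using square_pres_rel[OF assms(1,3)] by (rule pres_rel_context) (simp_all add: words)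
  ultimately have "([?s, ?t, ?s, ?t, ?s, ?t] @ [?t, ?s, ?t], [?s, ?t, ?s]) \<in> ?R"
    by (auto intro: pres_rel.trans)
  then show ?thesis using rel by (blast intro: pres_rel.sym pres_rel.trans)
qed

lemma word_elem_context:
  assumes "(map (\<lambda>s. (s, True)) \<beta>, map (\<lambda>s. (s, True)) \<gamma>) \<in> pres_rel S (coxeter_relators S m)"
    and "u \<in> lists S" "v \<in> lists S"
  shows "word_elem S m (u @ \<beta> @ v) = word_elem S m (u @ \<gamma> @ v)"
proof -
  have "map (\<lambda>s. (s, True)) u \<in> signed_words S" "map (\<lambda>s. (s, True)) v \<in> signed_words S"
    using assms(2,3) by (auto simp: signed_words_def in_lists_conv_set)
  from pres_rel_context[OF assms(1) this] show ?thesis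
    unfolding word_elem_def by (simp add: equiv_class_eq[OF equiv_pres_rel])
qed

lemma reduced_no_square:
  assumes "coxeter_matrix S m" "reduced_expression S m (u @ [s, s] @ v)"
  shows False
proof -
  have lists: "u \<in> lists S" "s \<in> S" "v \<in> lists S"
    using assms(2) by (auto simp: reduced_expression_def reduced_expression_for_def)
  have "word_elem S m (u @ [s, s] @ v) = word_elem S m (u @ [] @ v)"
    using square_pres_rel[OF assms(1) lists(2)] lists by (intro word_elem_context) simp_all
  moreover have "u @ [] @ v \<in> lists S" using lists by simp
  ultimately have "length (u @ [s, s] @ v) \<le> length (u @ [] @ v)"
    using assms(2) unfolding reduced_expression_def reduced_expression_for_def by metis
  then show False by simp
qed

lemma reduced_braid_move:
  assumes "coxeter_matrix S m" "braid_move S m \<beta> \<gamma>" "reduced_expression S m \<beta>"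
  shows "reduced_expression S m \<gamma>"
proof -
  obtain u v s t where st: "s \<in> S" "t \<in> S" "m s t = 3"
    and \<beta>: "\<beta> = u @ [s, t, s] @ v" and \<gamma>: "\<gamma> = u @ [t, s, t] @ v"
    using assms(2) unfolding braid_move_def by blast
  have lists: "u \<in> lists S" "v \<in> lists S"
    using assms(3) by (auto simp: \<beta> reduced_expression_def reduced_expression_for_def)
  have "word_elem S m \<beta> = word_elem S m \<gamma>"
    unfolding \<beta> \<gamma> using braid_pres_rel[OF assms(1) st] lists by (intro word_elem_context) simp_all
  moreover have "length \<beta> = length \<gamma>" "\<gamma> \<in> lists S" using lists st by (simp_all add: \<beta> \<gamma>)
  ultimately show ?thesis
    using assms(3) unfolding reduced_expression_def reduced_expression_for_def by metis
qed

lemma coxeter_matrix_3: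
  assumes "coxeter_matrix S m" "s \<in> S" "t \<in> S" "m s t = 3"
  shows "s \<noteq> t" "m t s = 3"
proof -
  show "s \<noteq> t" using assms by (auto simp: coxeter_matrix_def)
  then show "m t s = 3" using assms by (simp add: coxeter_matrix_def)
qed

lemma braid_move_sym:
  assumes "coxeter_matrix S m" "braid_move S m \<beta> \<gamma>"
  shows "braid_move S m \<gamma> \<beta>"
  using assms(2) coxeter_matrix_3(2)[OF assms(1)] unfolding braid_move_def by blast

lemma braid_move_neq:
  assumes "coxeter_matrix S m" "braid_move S m \<beta> \<gamma>"
  shows "\<beta> \<noteq> \<gamma>"
  using assms(2) coxeter_matrix_3(1)[OF assms(1)] unfolding braid_move_def by auto

lemma bond_no_triangle:
  assumes "coxeter_matrix S m" "type_Lambda S m" "bond S m a b" "bond S m b c"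
  shows "\<not> bond S m a c"
proof
  assume "bond S m a c"
  then obtain x y z where S: "x \<in> S" "y \<in> S" "z \<in> S"
    and m: "m x y = 3" "m y z = 3" "m x z = 3"
    using assms(3,4) by (auto simp: bond_def)
  have "distinct [x, y, z]" using coxeter_matrix_3(1)[OF assms(1)] S m by auto
  moreover have "{x, y} \<in> snd (coxeter_graph S m)" "{y, z} \<in> snd (coxeter_graph S m)"
      "{x, z} \<in> snd (coxeter_graph S m)"
    unfolding coxeter_graph_def snd_conv using S m by (metis (mono_tags, lifting) mem_Collect_eq order_refl)+
  ultimately show False
    using assms(2) unfolding type_Lambda_def triangle_free_def by blast
qed

lemma braid_class_step:
  assumes "coxeter_matrix S m" "\<beta> \<in> braid_class S m \<alpha>" "braid_move S m \<beta> \<gamma>"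
  shows "\<gamma> \<in> braid_class S m \<alpha>"
  using assms reduced_braid_move unfolding braid_class_def
  by (auto intro: rtranclp.rtrancl_into_rtrancl)

lemma braid_moves_length: "(braid_move S m)\<^sup>*\<^sup>* \<alpha> \<beta> \<Longrightarrow> length \<beta> = length \<alpha>"
  by (induction rule: rtranclp_induct) (auto simp: braid_move_def)

lemma braid_family_braid_class:
  assumes cox: "coxeter_matrix S m" and Lambda: "type_Lambda S m"
  shows "braid_family (bond S m) (word_fun ` braid_class S m \<alpha>)"
proof
  show "bond S m b a" if "bond S m a b" for a b
    using that coxeter_matrix_3(2)[OF cox] by (auto simp: bond_def)
  show "\<not> bond S m a c" if "bond S m a b" "bond S m b c" for a b c
    using bond_no_triangle[OF cox Lambda that] .
next
  fix u i assume "u \<in> word_fun ` braid_class S m \<alpha>" "braidable (bond S m) i u"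
  then obtain \<beta> where \<beta>: "\<beta> \<in> braid_class S m \<alpha>" "u = word_fun \<beta>"
      "braidable (bond S m) i (word_fun \<beta>)" by blast
  obtain \<gamma> where "braid_move S m \<beta> \<gamma>" "word_fun \<gamma> = braid i u"
    using braidable_word_fun[OF \<beta>(3)] \<beta>(2) by metis
  then show "braid i u \<in> word_fun ` braid_class S m \<alpha>"
    using braid_class_step[OF cox \<beta>(1)] by (metis imageI)
next
  fix u v assume "u \<in> word_fun ` braid_class S m \<alpha>" "v \<in> word_fun ` braid_class S m \<alpha>"
  then obtain \<beta> \<gamma> where u: "u = word_fun \<beta>" and v: "v = word_fun \<gamma>"
    and "(braid_move S m)\<^sup>*\<^sup>* \<alpha> \<beta>" and \<gamma>: "(braid_move S m)\<^sup>*\<^sup>* \<alpha> \<gamma>"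
    by (auto simp: braid_class_def)
  moreover have "symp (braid_move S m)" using braid_move_sym[OF cox] by (auto intro: sympI)
  ultimately have "(braid_move S m)\<^sup>*\<^sup>* \<beta> \<alpha>" by (metis symp_rtranclp sympD)
  then have "(braid_move S m)\<^sup>*\<^sup>* \<beta> \<gamma>" using \<gamma> by (rule rtranclp_trans)
  then show "(braid_step (bond S m))\<^sup>*\<^sup>* u v"
    unfolding u v
  proof (induction rule: rtranclp_induct)
    case (step \<gamma> \<delta>)
    have "braid_step (bond S m) (word_fun \<gamma>) (word_fun \<delta>)"
      using braid_move_word_fun[OF step(2)] unfolding braid_step_def by metis
    with step.IH show ?case by (auto intro: rtranclp.rtrancl_into_rtrancl)
  qed simp
next
  fix u i b assume "u \<in> word_fun ` braid_class S m \<alpha>" "bond S m (u i) b"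
  then obtain \<beta> s where red: "reduced_expression S m \<beta>" and u: "u = word_fun \<beta>" and ui: "u i = Some s"
    by (auto simp: braid_class_def bond_def)
  show "u (i + 1) \<noteq> u i"
  proof
    assume "u (i + 1) = u i"
    then have len: "i + 1 < length \<beta>" and nth: "\<beta> ! i = s" "\<beta> ! (i + 1) = s"
      using ui by (auto simp: u word_fun_def split: if_splits)
    then have "drop i \<beta> = [s, s] @ drop (i + 2) \<beta>"
      by (simp add: Cons_nth_drop_Suc[symmetric])
    then have "\<beta> = take i \<beta> @ [s, s] @ drop (i + 2) \<beta>" by (metis append_take_drop_id)
    then show False using reduced_no_square[OF cox] red by metis
  qed
qed

theorem corollary8p2:
  fixes S :: "'a set" and m :: "'a \<Rightarrow> 'a \<Rightarrow> enat" and \<alpha> :: "'a list"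
  assumes "coxeter_matrix S m"
    and "type_Lambda S m"
    and "reduced_expression S m \<alpha>"
  shows "median_graph (braid_graph S m \<alpha>)"
proof -
  define G V f where "G = braid_graph S m \<alpha>" and "V = braid_class S m \<alpha>"
    and "f \<beta> i = word_fun \<beta> (i + 1)" for \<beta> :: "'a list" and i :: nat
  interpret words: braid_family "bond S m" "word_fun ` V"
    unfolding V_def by (rule braid_family_braid_class[OF assms(1,2)])
  let ?C = words.sites
  have vertices: "fst G = V" by (simp add: G_def V_def braid_graph_def)
  have edge_iff: "{\<beta>, \<gamma>} \<in> snd G \<longleftrightarrow> \<beta> \<in> V \<and> \<gamma> \<in> V \<and> braid_move S m \<beta> \<gamma>" for \<beta> \<gamma>
    using braid_move_sym[OF assms(1)] by (auto simp: G_def V_def braid_graph_def doubleton_eq_iff)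
  have site_move: "i \<in> ?C" if "\<beta> \<in> V" "braidable (bond S m) i (word_fun \<beta>)" for \<beta> i
    using that unfolding words.sites_def by blast
  have other: "f \<gamma> j = f \<beta> j"
    if "i \<in> ?C" "j \<in> ?C" "j \<noteq> i" "word_fun \<gamma> = braid i (word_fun \<beta>)" for i j \<beta> \<gamma>
    unfolding f_def that(4) by (rule words.braid_other_centre[OF that(1-3)])
  have "?C \<subseteq> {..<length \<alpha>}"
  proof
    fix i assume "i \<in> ?C"
    then obtain \<beta> where "\<beta> \<in> V" "braidable (bond S m) i (word_fun \<beta>)" by (auto simp: words.sites_def)
    then have "length \<beta> = length \<alpha>" "i < length \<beta>"
      using braid_moves_length braidable_word_fun by (auto simp: V_def braid_class_def)
    then show "i \<in> {..<length \<alpha>}" by simp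
  qed
  then have fin: "finite ?C" by (rule finite_subset) simp
  have "labelled_graph G ?C f"
  proof (rule labelled_graph.intro)
    show "simple_graph G"
      using braid_move_neq[OF assms(1)] by (fastforce simp: G_def simple_graph_def braid_graph_def)
    show "finite ?C" by (rule fin)
  next
    fix \<beta> \<gamma> assume V: "\<beta> \<in> fst G" "\<gamma> \<in> fst G" and agree: "disagree ?C (f \<beta>) (f \<gamma>) = {}"
    have "word_fun \<beta> = word_fun \<gamma>"
    proof (rule words.determined_by_centres)
      show "word_fun \<beta> \<in> word_fun ` V" "word_fun \<gamma> \<in> word_fun ` V" using V vertices by auto
      show "word_fun \<beta> (i + 1) = word_fun \<gamma> (i + 1)" if "i \<in> ?C" for i
        using agree that unfolding disagree_def f_def by blast
    qed
    then show "\<beta> = \<gamma>" by (rule injD[OF inj_word_fun])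
  next
    fix \<beta> \<gamma> \<delta> i assume V: "\<beta> \<in> fst G" "\<gamma> \<in> fst G" "\<delta> \<in> fst G" and i: "i \<in> ?C"
    obtain a b where "\<And>v. v \<in> word_fun ` V \<Longrightarrow> v (i + 1) \<in> {a, b}"
      using words.centre_pair[OF i] by blast
    then have "f \<beta> i \<in> {a, b}" "f \<gamma> i \<in> {a, b}" "f \<delta> i \<in> {a, b}"
      using V unfolding vertices f_def by blast+
    then show "f \<beta> i = f \<gamma> i \<or> f \<beta> i = f \<delta> i \<or> f \<gamma> i = f \<delta> i" by auto
  next
    fix \<beta> \<gamma> assume e: "{\<beta>, \<gamma>} \<in> snd G"
    then obtain i where i: "braidable (bond S m) i (word_fun \<beta>)" "word_fun \<gamma> = braid i (word_fun \<beta>)"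
      using braid_move_word_fun edge_iff by metis
    have "i \<in> ?C" using site_move i(1) e edge_iff by blast
    then have "disagree ?C (f \<beta>) (f \<gamma>) \<subseteq> {i}"
      using other[OF _ _ _ i(2)] unfolding disagree_def by fastforce
    then have "card (disagree ?C (f \<beta>) (f \<gamma>)) \<le> card {i}"
      by (rule card_mono[rotated]) simp
    then show "card (disagree ?C (f \<beta>) (f \<gamma>)) \<le> 1" by simp
  next
    fix \<beta> x
    assume \<beta>: "\<beta> \<in> fst G" and real: "\<forall>i\<in>?C. \<forall>j\<in>?C. \<exists>\<delta>\<in>fst G. f \<delta> i = x i \<and> f \<delta> j = x j"
      and differ: "disagree ?C (f \<beta>) x \<noteq> {}"
    have "\<exists>i\<in>?C. braidable (bond S m) i (word_fun \<beta>) \<and> word_fun \<beta> (i + 1) \<noteq> x i \<and> word_fun \<beta> i = x i"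
    proof (rule words.braid_towards[OF fin])
      show "word_fun \<beta> \<in> word_fun ` V" using \<beta> vertices by auto
      show "\<exists>w\<in>word_fun ` V. w (i + 1) = x i \<and> w (j + 1) = x j" if "i \<in> ?C" "j \<in> ?C" for i j
        using real that unfolding vertices f_def by blast
      show "\<exists>i\<in>?C. word_fun \<beta> (i + 1) \<noteq> x i"
        using differ unfolding disagree_def f_def by blast
    qed
    then obtain i where i: "i \<in> ?C" "braidable (bond S m) i (word_fun \<beta>)"
        "f \<beta> i \<noteq> x i" "word_fun \<beta> i = x i" unfolding f_def by blast
    obtain \<gamma> where \<gamma>: "braid_move S m \<beta> \<gamma>" "word_fun \<gamma> = braid i (word_fun \<beta>)"
      using braidable_word_fun[OF i(2)] by metis
    have V: "\<gamma> \<in> V" using braid_class_step[OF assms(1) _ \<gamma>(1)] \<beta> vertices by (simp add: V_def)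
    have "f \<gamma> i = x i" unfolding f_def \<gamma>(2) braid_centre by (rule i(4))
    then have "disagree ?C (f \<gamma>) x \<subset> disagree ?C (f \<beta>) x"
      using i(1,3) other[OF i(1) _ _ \<gamma>(2)] unfolding disagree_def by fastforce
    then show "\<exists>\<gamma>\<in>fst G. {\<beta>, \<gamma>} \<in> snd G \<and> disagree ?C (f \<gamma>) x \<subset> disagree ?C (f \<beta>) x"
      using \<beta> \<gamma>(1) V edge_iff vertices by blast
  qed
  then show ?thesis unfolding G_def by (rule labelled_graph.median)
qed

end
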